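(* In the weighted graph setting described in the context, the boundary layer operators satisfy $$SH=-D^2+\tfrac I4,\qquad HS=-(D')^2+\tfrac I4,\qquad SD'=DS,\qquad D'H=HD,$$ where $I$ is the $|\partial\Omega|\times|\partial\Omega|$ identity matrix.
   Context: Graph. $\mathcal G=(\mathcal V,\mathcal E)$ is a finite connected undirected graph without self-edges. $\mathcal V$ is partitioned into four nonempty disjoint sets $B,\Omega^+,\partial\Omega,\Omega^-$ such that, among pairs of distinct sets of the partition, the only ones joined by at least one edge are $\{B,\Omega^+\}$, $\{\Omega^+,\partial\Omega\}$, $\{\partial\Omega,\Omega^-\}$ (so there are no edges between $B$ and $\partial\Omega$, $B$ and $\Omega^-$, or $\Omega^+$ and $\Omega^-$). Put $\mathcal V^\circ=\mathcal V\setminus B$. Laplacian. The discrete gradient $\nabla$ is the $|\mathcal E|\times|\mathcal V|$ matrix with $(\nabla u)_k=u_i-u_j$, where $i,j$ are the endpoints of edge $k$ in a fixed order. For $s\in[0,\infty)^{|\mathcal E|}$, $L(s)=\nabla^T\mathrm{diag}(s)\nabla$. A conductivity $\sigma\in(0,\infty)^{|\mathcal E|}$ is fixed. $L[X,Y]$ denotes the submatrix with rows $X$, columns $Y$; $R_X$ is the $|X|\times|\mathcal V|$ matrix with $R_Xu=u|_X$. Green function. $G=R_{\mathcal V^\circ}^T\,L(\sigma)[\mathcal V^\circ,\mathcal V^\circ]^{-1}R_{\mathcal V^\circ}$ (the inverse exists since $\mathcal G$ is connected). Edge partition of unity. Let $\mathcal E^+$ be the edges with at least one node in $B\cup\Omega^+$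 and $\mathcal E^-$ the edges with at least one node in $\Omega^-$. Fix any $p^+,p^-\in[0,1]^{|\mathcal E|}$ with $p^++p^-=1$, $p^+|_{\mathcal E^+}=1$, $p^-|_{\mathcal E^-}=1$. Set $\sigma^\pm=p^\pm\sigma$ (componentwise), so $L(\sigma)=L(\sigma^+)+L(\sigma^-)$. Traces and potentials. $\gamma_0=R_{\partial\Omega}$, $\gamma_1^\pm=\mp R_{\partial\Omega}L(\sigma^\pm)$, $\mathcal S=G\gamma_0^T$, $\mathcal D^\pm=G[\gamma_1^\pm]^T$. Boundary layer operators ($|\partial\Omega|\times|\partial\Omega|$ matrices). $S=\gamma_0\mathcal S$, $D=\frac12\gamma_0(\mathcal D^++\mathcal D^-)$, $D'=\frac12(\gamma_1^++\gamma_1^-)\mathcal S=D^T$, $H=-\gamma_1^+\mathcal D^-$ (which coincides with $-\gamma_1^-\mathcal D^+$). *)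

theory Defs
  imports "HOL-Analysis.Analysis"
begin

text \<open>
  The nodes are the elements of the finite type \<open>'v\<close> and the edges those of the finite type \<open>'e\<close>, so that
  vectors indexed by nodes and edges have types \<open>real ^ 'v\<close> and \<open>real ^ 'e\<close>. The endpoints of the
  edge \<open>k\<close>, in a fixed order, are \<open>src N k\<close> and \<open>tgt N k\<close>; this order has no meaning
  beyond fixing the sign of the gradient. The finite types \<open>'o\<close> and \<open>'d\<close> are index types
  for the proper subsets \<open>-B\<close> and \<open>\<partial>\<Omega>\<close> of the nodes: \<open>int_node N\<close> and
  \<open>bd_node N\<close> enumerate these sets without repetition. Thus matrices of type
  \<open>real ^ 'd ^ 'd\<close> are the matrices whose rows and columns are indexed by \<open>\<partial>\<Omega>\<close>.
\<close>

record ('v, 'e::finite, 'o, 'd) network =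
  src :: "'e \<Rightarrow> 'v"
  tgt :: "'e \<Rightarrow> 'v"
  B_set :: "'v set"
  Omega_plus :: "'v set"
  bd_Omega :: "'v set"
  Omega_minus :: "'v set"
  conductivity :: "real ^ 'e"
  p_plus :: "real ^ 'e"
  p_minus :: "real ^ 'e"
  int_node :: "'o \<Rightarrow> 'v"
  bd_node :: "'d \<Rightarrow> 'v"

definition adjacency :: "('v::finite, 'e::finite, 'o::finite, 'd::finite) network \<Rightarrow> ('v \<times> 'v) set" where
  "adjacency N = {(u, v). \<exists>k. {src N k, tgt N k} = {u, v}}"

definition joined :: "('v::finite, 'e::finite, 'o::finite, 'd::finite) network \<Rightarrow> 'v set \<Rightarrow> 'v set \<Rightarrow> bool" where
  "joined N X Y \<longleftrightarrow> (\<exists>u\<in>X. \<exists>v\<in>Y. (u, v) \<in> adjacency N)"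

definition edges_plus :: "('v::finite, 'e::finite, 'o::finite, 'd::finite) network \<Rightarrow> 'e set" where
  "edges_plus N = {k. {src N k, tgt N k} \<inter> (B_set N \<union> Omega_plus N) \<noteq> {}}"

definition edges_minus :: "('v::finite, 'e::finite, 'o::finite, 'd::finite) network \<Rightarrow> 'e set" where
  "edges_minus N = {k. {src N k, tgt N k} \<inter> Omega_minus N \<noteq> {}}"

text \<open>In the last assumptions, \<open>1\<close> and \<open>+\<close> on \<open>real ^ 'e\<close> are componentwise.\<close>

locale layered_network =
  fixes N :: "('v::finite, 'e::finite, 'o::finite, 'd::finite) network"
  assumes no_self_edges: "\<And>k. src N k \<noteq> tgt N k"
    and no_parallel_edges: "inj (\<lambda>k. {src N k, tgt N k})"
    and connected_graph: "\<And>u v. (u, v) \<in> (adjacency N)\<^sup>*"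
    and nonempty: "B_set N \<noteq> {}" "Omega_plus N \<noteq> {}" "bd_Omega N \<noteq> {}" "Omega_minus N \<noteq> {}"
    and cover: "B_set N \<union> Omega_plus N \<union> bd_Omega N \<union> Omega_minus N = UNIV"
    and disjoint_sets:
      "B_set N \<inter> Omega_plus N = {}" "B_set N \<inter> bd_Omega N = {}" "B_set N \<inter> Omega_minus N = {}"
      "Omega_plus N \<inter> bd_Omega N = {}" "Omega_plus N \<inter> Omega_minus N = {}"
      "bd_Omega N \<inter> Omega_minus N = {}"
    and joined_sets:
      "joined N (B_set N) (Omega_plus N)" "joined N (Omega_plus N) (bd_Omega N)"
      "joined N (bd_Omega N) (Omega_minus N)"
    and not_joined_sets:
      "\<not> joined N (B_set N) (bd_Omega N)" "\<not> joined N (B_set N) (Omega_minus N)"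
      "\<not> joined N (Omega_plus N) (Omega_minus N)"
    and int_node: "bij_betw (int_node N) UNIV (- B_set N)"
    and bd_node: "bij_betw (bd_node N) UNIV (bd_Omega N)"
    and conductivity_pos: "\<And>k. conductivity N $ k > 0"
    and p_plus_range: "\<And>k. p_plus N $ k \<in> {0..1}"
    and p_minus_range: "\<And>k. p_minus N $ k \<in> {0..1}"
    and partition_of_unity: "p_plus N + p_minus N = 1"
    and p_plus_edges: "\<And>k. k \<in> edges_plus N \<Longrightarrow> p_plus N $ k = 1"
    and p_minus_edges: "\<And>k. k \<in> edges_minus N \<Longrightarrow> p_minus N $ k = 1"

definition gradient :: "('v::finite, 'e::finite, 'o::finite, 'd::finite) network \<Rightarrow> real ^ 'v ^ 'e" where
  "gradient N = matrix (\<lambda>u :: real ^ 'v. \<chi> k. u $ src N k - u $ tgt N k)"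

definition diag_matrix :: "real ^ 'n \<Rightarrow> real ^ 'n ^ 'n::finite" where
  "diag_matrix s = (\<chi> i j. if i = j then s $ i else 0)"

definition laplacian :: "('v::finite, 'e::finite, 'o::finite, 'd::finite) network \<Rightarrow> real ^ 'e \<Rightarrow> real ^ 'v ^ 'v" where
  "laplacian N s = transpose (gradient N) ** diag_matrix s ** gradient N"

text \<open>For enumerations \<open>f\<close> of \<open>X\<close> and \<open>g\<close> of \<open>Y\<close>, the following are the
  restriction matrix \<open>R\<^sub>X\<close> and the submatrix \<open>A[X,Y]\<close>.\<close>

definition restriction :: "('x::finite \<Rightarrow> 'v::finite) \<Rightarrow> real ^ 'v ^ 'x" where
  "restriction f = matrix (\<lambda>u :: real ^ 'v. \<chi> i. u $ f i)"

definition submatrix :: "real ^ 'w ^ 'v \<Rightarrow> ('x::finite \<Rightarrow> 'v::finite) \<Rightarrow> ('y::finite \<Rightarrow> 'w::finite) \<Rightarrow> real ^ 'y ^ 'x" where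
  "submatrix A f g = (\<chi> i j. A $ f i $ g j)"

definition green :: "('v::finite, 'e::finite, 'o::finite, 'd::finite) network \<Rightarrow> real ^ 'v ^ 'v" where
  "green N = transpose (restriction (int_node N))
     ** matrix_inv (submatrix (laplacian N (conductivity N)) (int_node N) (int_node N))
     ** restriction (int_node N)"

text \<open>Multiplication on \<open>real ^ 'e\<close> is componentwise.\<close>

definition sigma_plus :: "('v::finite, 'e::finite, 'o::finite, 'd::finite) network \<Rightarrow> real ^ 'e" where
  "sigma_plus N = p_plus N * conductivity N"

definition sigma_minus :: "('v::finite, 'e::finite, 'o::finite, 'd::finite) network \<Rightarrow> real ^ 'e" where
  "sigma_minus N = p_minus N * conductivity N"

definition gamma0 :: "('v::finite, 'e::finite, 'o::finite, 'd::finite) network \<Rightarrow> real ^ 'v ^ 'd" where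
  "gamma0 N = restriction (bd_node N)"

definition gamma1_plus :: "('v::finite, 'e::finite, 'o::finite, 'd::finite) network \<Rightarrow> real ^ 'v ^ 'd" where
  "gamma1_plus N = - (restriction (bd_node N) ** laplacian N (sigma_plus N))"

definition gamma1_minus :: "('v::finite, 'e::finite, 'o::finite, 'd::finite) network \<Rightarrow> real ^ 'v ^ 'd" where
  "gamma1_minus N = restriction (bd_node N) ** laplacian N (sigma_minus N)"

definition single_layer_potential ::
    "('v::finite, 'e::finite, 'o::finite, 'd::finite) network \<Rightarrow> real ^ 'd ^ 'v" where
  "single_layer_potential N = green N ** transpose (gamma0 N)"

definition double_layer_potential_plus ::
    "('v::finite, 'e::finite, 'o::finite, 'd::finite) network \<Rightarrow> real ^ 'd ^ 'v" where
  "double_layer_potential_plus N = green N ** transpose (gamma1_plus N)"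

definition double_layer_potential_minus ::
    "('v::finite, 'e::finite, 'o::finite, 'd::finite) network \<Rightarrow> real ^ 'd ^ 'v" where
  "double_layer_potential_minus N = green N ** transpose (gamma1_minus N)"

definition S_op :: "('v::finite, 'e::finite, 'o::finite, 'd::finite) network \<Rightarrow> real ^ 'd ^ 'd" where
  "S_op N = gamma0 N ** single_layer_potential N"

definition D_op :: "('v::finite, 'e::finite, 'o::finite, 'd::finite) network \<Rightarrow> real ^ 'd ^ 'd" where
  "D_op N = (1/2) *\<^sub>R
     (gamma0 N ** (double_layer_potential_plus N + double_layer_potential_minus N))"

definition D'_op :: "('v::finite, 'e::finite, 'o::finite, 'd::finite) network \<Rightarrow> real ^ 'd ^ 'd" where
  "D'_op N = (1/2) *\<^sub>R ((gamma1_plus N + gamma1_minus N) ** single_layer_potential N)"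

definition H_op :: "('v::finite, 'e::finite, 'o::finite, 'd::finite) network \<Rightarrow> real ^ 'd ^ 'd" where
  "H_op N = - (gamma1_plus N ** double_layer_potential_minus N)"

end

theory Submission
  imports Defs
begin

text \<open>
  Let \<open>Q\<close> and \<open>X\<close> be the coordinate projections onto \<open>\<partial>\<Omega>\<close> and \<open>B \<union> \<Omega>\<^sup>+\<close>, and write \<open>L\<^sup>\<plusminus>\<close> for
  \<open>L(\<sigma>\<^sup>\<plusminus>)\<close>. The rows of \<open>L\<^sup>+\<close> vanish on \<open>\<Omega>\<^sup>-\<close> and those of \<open>L\<^sup>-\<close> vanish on \<open>B \<union> \<Omega>\<^sup>+\<close>, so that
  \<open>L\<^sup>+ = Q L\<^sup>+ + X L = L\<^sup>+ Q + L X\<close>. Multiplying by \<open>G\<close> on both sides and using \<open>G X L G = G X\<close>,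
  \<open>G L X G = X G\<close> gives Green's identity \<open>G (Q L\<^sup>+ - L\<^sup>+ Q) G = X G - G X\<close>, whose right-hand side
  disappears between boundary traces. Combined with the jump relation
  \<open>\<gamma>\<^sub>0 G L\<^sup>+ \<gamma>\<^sub>0\<^sup>T + \<gamma>\<^sub>0 G L\<^sup>- \<gamma>\<^sub>0\<^sup>T = I\<close> it yields all four identities.
\<close>

section \<open>Matrix algebra\<close>

lemma matrix_add_rdistrib: "(A + B) ** C = A ** C + B ** C"
  for A B :: "'a::semiring_1 ^ 'n::finite ^ 'm"
  by (simp add: matrix_matrix_mult_def vec_eq_iff distrib_right sum.distrib)

lemma matrix_diff_ldistrib: "A ** (B - C) = A ** B - A ** C"
  for A :: "'a::ring_1 ^ 'n::finite ^ 'm"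
  by (simp add: matrix_matrix_mult_def vec_eq_iff right_diff_distrib sum_subtractf)

lemma matrix_diff_rdistrib: "(A - B) ** C = A ** C - B ** C"
  for A B :: "'a::ring_1 ^ 'n::finite ^ 'm"
  by (simp add: matrix_matrix_mult_def vec_eq_iff left_diff_distrib sum_subtractf)

lemma matrix_minus_left: "(- A) ** B = - (A ** B)"
  for A :: "'a::ring_1 ^ 'n::finite ^ 'm"
  by (simp add: matrix_matrix_mult_def vec_eq_iff sum_negf)

lemma matrix_minus_right: "A ** (- B) = - (A ** B)"
  for A :: "'a::ring_1 ^ 'n::finite ^ 'm"
  by (simp add: matrix_matrix_mult_def vec_eq_iff sum_negf)

lemma transpose_uminus: "transpose (- A) = - transpose A"
  by (simp add: transpose_def vec_eq_iff)

lemma transpose_add: "transpose (A + B) = transpose A + transpose B"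
  by (simp add: transpose_def vec_eq_iff)

lemma matrix_inv_inverse:
  fixes A :: "'a::semiring_1 ^ 'n ^ 'm"
  assumes "invertible A"
  shows "A ** matrix_inv A = mat 1" "matrix_inv A ** A = mat 1"
proof -
  have "A ** matrix_inv A = mat 1 \<and> matrix_inv A ** A = mat 1"
    using assms unfolding invertible_def matrix_inv_def by (rule someI_ex)
  then show "A ** matrix_inv A = mat 1" "matrix_inv A ** A = mat 1"
    by auto
qed

section \<open>Coordinate projections and restriction matrices\<close>

definition set_projection :: "'v set \<Rightarrow> real ^ 'v ^ 'v::finite" where
  "set_projection A = diag_matrix (\<chi> i. indicator A i)"

lemma set_projection_mult_nth: "(set_projection A ** M) $ i $ j = indicator A i * M $ i $ j"
  by (simp add: set_projection_def diag_matrix_def matrix_matrix_mult_def if_distrib[of "\<lambda>x. x * _"]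
        cong: if_cong)

lemma mult_set_projection_nth: "(M ** set_projection A) $ i $ j = M $ i $ j * indicator A j"
  by (simp add: set_projection_def diag_matrix_def matrix_matrix_mult_def if_distrib[of "\<lambda>x. _ * x"]
        cong: if_cong)

lemma restriction_nth: "restriction f $ i $ j = (if f i = j then 1 else 0)"
  by (auto simp: restriction_def matrix_def axis_def)

lemma submatrix_eq: "submatrix A f g = restriction f ** A ** transpose (restriction g)"
  by (simp add: submatrix_def vec_eq_iff matrix_matrix_mult_def restriction_nth transpose_def
        if_distrib[of "\<lambda>x. x * _"] if_distrib[of "\<lambda>x. _ * x"] cong: if_cong)

lemma restriction_mult_transpose:
  assumes "inj f"
  shows "restriction f ** transpose (restriction f) = mat 1"
  using assms
  by (simp add: vec_eq_iff matrix_matrix_mult_def restriction_nth transpose_def mat_def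
        if_distrib[of "\<lambda>x. x * _"] inj_eq eq_commute cong: if_cong)

lemma transpose_mult_restriction:
  assumes "inj f"
  shows "transpose (restriction f) ** restriction f = set_projection (range f)"
proof -
  have "(\<Sum>k\<in>UNIV. (if f k = i then 1 else 0) * (if f k = j then 1 else 0 :: real))
      = indicator (range f) i * (if i = j then 1 else 0)" for i j
  proof (cases "i \<in> range f")
    case True
    then obtain m where i: "i = f m" by auto
    have "f k = i \<longleftrightarrow> k = m" for k
      using assms by (auto simp: i inj_eq)
    then show ?thesis
      by (simp add: i if_distrib[of "\<lambda>x. x * _"] cong: if_cong)
  next
    case False
    then have "f k \<noteq> i" for k by auto
    with False show ?thesis by simp
  qed
  then show ?thesis
    by (simp add: vec_eq_iff matrix_matrix_mult_def restriction_nth transpose_def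
          set_projection_def diag_matrix_def)
qed

lemma restriction_mult_set_projection:
  "range f \<inter> A = {} \<Longrightarrow> restriction f ** set_projection A = 0"
  by (auto simp: vec_eq_iff mult_set_projection_nth restriction_nth indicator_def)

lemma transpose_set_projection: "transpose (set_projection A) = set_projection A"
  by (auto simp: set_projection_def diag_matrix_def transpose_def vec_eq_iff)

section \<open>Boundary layer identities\<close>

text \<open>A pure matrix form of the setting, with \<open>R\<close> the trace
  \<open>gamma0 N\<close>. Since \<open>G\<close> inverts the Laplacian only off \<open>B\<close>,
  the last two assumptions state the inversion after multiplication by \<open>R\<close> or
  \<open>G ** X\<close>, which suppress the rows in \<open>B\<close>.\<close>

locale calderon_data =
  fixes R :: "real ^ 'v::finite ^ 'd::finite"
    and G X Lp Lm :: "real ^ 'v ^ 'v"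
  assumes R_section: "R ** transpose R = mat 1"
    and R_X: "R ** X = 0"
    and sym: "transpose G = G" "transpose X = X" "transpose Lp = Lp" "transpose Lm = Lm"
    and X_Lm: "X ** Lm = 0"
    and Lp_split: "transpose R ** R ** Lp + X ** Lp = Lp"
    and R_Lap_G: "R ** (Lp + Lm) ** G = R"
    and G_X_Lap_G: "G ** X ** (Lp + Lm) ** G = G ** X"
begin

abbreviation "S \<equiv> R ** G ** transpose R"
abbreviation "H \<equiv> R ** Lp ** G ** Lm ** transpose R"
text \<open>In the network, \<open>Km\<close> is the trace of the minus double layer potential,
  while \<open>K\<close> is the negative of the trace of the plus one; hence \<open>D_op N\<close>
  is half of \<open>Km - K\<close>.\<close>

abbreviation "K \<equiv> R ** G ** Lp ** transpose R"
abbreviation "Km \<equiv> R ** G ** Lm ** transpose R"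
abbreviation "K' \<equiv> R ** Lp ** G ** transpose R"
abbreviation "Km' \<equiv> R ** Lm ** G ** transpose R"

lemma X_transpose_R: "X ** transpose R = 0"
  using arg_cong[OF R_X, of transpose] by (simp add: matrix_transpose_mul sym)
    (simp add: transpose_def vec_eq_iff)

lemma transposed_split: "Lp ** transpose R ** R + Lp ** X = Lp"
  using arg_cong[OF Lp_split, of transpose]
  by (simp add: matrix_transpose_mul sym transpose_add matrix_mul_assoc)

lemma G_Lap_transpose_R: "G ** (Lp + Lm) ** transpose R = transpose R"
  using arg_cong[OF R_Lap_G, of transpose]
  by (simp add: matrix_transpose_mul sym transpose_add matrix_mul_assoc)

lemma G_Lap_X_G: "G ** (Lp + Lm) ** X ** G = X ** G"
  using arg_cong[OF G_X_Lap_G, of transpose]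
  by (simp add: matrix_transpose_mul sym transpose_add matrix_mul_assoc)

lemma Lm_X: "Lm ** X = 0"
  using arg_cong[OF X_Lm, of transpose] by (simp add: matrix_transpose_mul sym)
    (simp add: transpose_def vec_eq_iff)

lemma green_identity:
  "G ** transpose R ** R ** Lp ** G + G ** X = X ** G + G ** Lp ** transpose R ** R ** G"
proof -
  \<comment> \<open>Because \<open>Lm\<close> is invisible to \<open>X\<close>, the full Laplacian
    next to \<open>X\<close> may be replaced by \<open>Lp\<close>.\<close>
  have "G ** X ** Lm = 0" "G ** Lm ** X = 0"
    by (simp_all add: X_Lm Lm_X flip: matrix_mul_assoc)
  then have "G ** X ** Lp ** G = G ** X" "G ** Lp ** X ** G = X ** G"
    using G_X_Lap_G G_Lap_X_G
    by (simp_all add: matrix_add_ldistrib matrix_add_rdistrib)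
  \<comment> \<open>Both sides are \<open>G ** Lp ** G\<close>, with \<open>Lp\<close> split by rows
    on the left and by columns on the right.\<close>
  moreover have "G ** (transpose R ** R ** Lp + X ** Lp) ** G = G ** (Lp ** transpose R ** R + Lp ** X) ** G"
    by (simp only: Lp_split transposed_split)
  ultimately show ?thesis
    by (simp add: matrix_add_ldistrib matrix_add_rdistrib matrix_mul_assoc add.commute)
qed

lemma green_identity_between:
  assumes "A ** X ** G ** C = 0" "A ** G ** X ** C = 0"
  shows "A ** G ** transpose R ** R ** Lp ** G ** C = A ** G ** Lp ** transpose R ** R ** G ** C"
proof -
  have "A ** (G ** transpose R ** R ** Lp ** G + G ** X) ** C
      = A ** (X ** G + G ** Lp ** transpose R ** R ** G) ** C"
    by (simp only: green_identity)
  with assms show ?thesis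
    by (simp add: matrix_add_ldistrib matrix_add_rdistrib matrix_mul_assoc)
qed

text \<open>\<open>G\<close> undoes the Laplacian on \<open>transpose R\<close>, and the trace of
  \<open>transpose R\<close> is the identity.\<close>

lemma jump: "K + Km = mat 1"
  using arg_cong[OF G_Lap_transpose_R, of "(**) R"]
  by (simp add: matrix_add_ldistrib matrix_add_rdistrib matrix_mul_assoc R_section)

lemma transpose_ops: "transpose S = S" "transpose K = K'" "transpose Km = Km'"
  by (simp_all add: matrix_transpose_mul sym matrix_mul_assoc)

lemma jump': "K' + Km' = mat 1"
  using arg_cong[OF jump, of transpose] by (simp add: transpose_add transpose_ops)

text \<open>Putting the full Laplacian in place of \<open>Lm\<close>, on either side of
  \<open>G\<close>, gives the same matrix \<open>R ** Lp ** transpose R\<close>; cancelling the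
  common term with two factors \<open>Lp\<close> shows that the roles of plus and minus in
  \<open>H\<close> can be exchanged.\<close>

lemma transpose_H: "transpose H = H"
proof -
  have "R ** (Lp + Lm) ** G ** Lp ** transpose R = R ** Lp ** transpose R"
    by (simp add: R_Lap_G)
  moreover have "R ** Lp ** (G ** (Lp + Lm) ** transpose R) = R ** Lp ** transpose R"
    by (simp add: G_Lap_transpose_R)
  ultimately have "R ** Lm ** G ** Lp ** transpose R = H"
    by (simp add: matrix_add_ldistrib matrix_add_rdistrib matrix_mul_assoc)
      (metis add_left_cancel)
  then show ?thesis
    by (simp add: matrix_transpose_mul sym matrix_mul_assoc)
qed

lemma S_H: "S ** H = K ** Km"
  using green_identity_between[of R "Lm ** transpose R"]
  by (simp add: R_X matrix_mul_assoc)
    (simp add: X_Lm flip: matrix_mul_assoc)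

lemma S_K': "S ** K' = K ** S"
  using green_identity_between[of R "transpose R"]
  by (simp add: R_X matrix_mul_assoc)
    (simp add: X_transpose_R flip: matrix_mul_assoc)

text \<open>Here Green's identity is preceded by \<open>R ** Lp\<close>, which does not kill
  \<open>X\<close>, so a term \<open>R ** Lp ** X ** G ** Lm ** transpose R\<close> survives. The
  column split of \<open>Lp\<close> recombines it with what the jump relation leaves of the other
  terms.\<close>

lemma K'_H: "K' ** H + H ** Km = H"
proof -
  have "R ** Lp ** (G ** transpose R ** R ** Lp ** G + G ** X) ** (Lm ** transpose R)
      = R ** Lp ** (X ** G + G ** Lp ** transpose R ** R ** G) ** (Lm ** transpose R)"
    by (simp only: green_identity)
  moreover have "R ** Lp ** G ** X ** Lm ** transpose R = 0"
    by (simp add: X_Lm flip: matrix_mul_assoc)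
  ultimately have "K' ** H = R ** Lp ** X ** G ** Lm ** transpose R
      + R ** Lp ** G ** Lp ** transpose R ** R ** G ** Lm ** transpose R"
    by (simp add: matrix_add_ldistrib matrix_add_rdistrib matrix_mul_assoc)
  moreover have "R ** Lp ** (G ** (Lp + Lm) ** transpose R) ** R ** G ** Lm ** transpose R
      = R ** Lp ** transpose R ** R ** G ** Lm ** transpose R"
    by (simp only: G_Lap_transpose_R)
  moreover have "R ** (Lp ** transpose R ** R + Lp ** X) ** G ** Lm ** transpose R = H"
    by (simp only: transposed_split)
  ultimately show ?thesis
    by (simp add: matrix_add_ldistrib matrix_add_rdistrib matrix_mul_assoc) (simp add: ac_simps)
qed

lemma H_S: "H ** S = Km' ** K'"
  using arg_cong[OF S_H, of transpose]
  by (simp only: matrix_transpose_mul[of S] matrix_transpose_mul[of K] transpose_ops transpose_H)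

end

section \<open>Graph Laplacians\<close>

lemma laplacian_nth:
  "laplacian N s $ i $ j = (\<Sum>k\<in>UNIV. s $ k *
     (indicator {src N k} i - indicator {tgt N k} i) * (indicator {src N k} j - indicator {tgt N k} j))"
  by (simp add: laplacian_def gradient_def diag_matrix_def matrix_matrix_mult_def transpose_def
        matrix_def axis_def if_distrib[of "\<lambda>x. _ * x"] indicator_def of_bool_def cong: if_cong)
   (simp add: mult_ac eq_commute)

lemma laplacian_sym: "transpose (laplacian N s) = laplacian N s"
  by (simp add: vec_eq_iff transpose_def laplacian_nth mult_ac)

lemma laplacian_add: "laplacian N (s + t) = laplacian N s + laplacian N t"
  by (simp add: vec_eq_iff laplacian_nth distrib_right sum.distrib)

lemma laplacian_row_eq_0:
  assumes "\<And>k. i \<in> {src N k, tgt N k} \<Longrightarrow> s $ k = 0"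
  shows "laplacian N s $ i $ j = 0"
  unfolding laplacian_nth by (rule sum.neutral) (use assms in \<open>auto simp: indicator_def\<close>)

lemma gradient_mult_nth: "(gradient N *v u) $ k = u $ src N k - u $ tgt N k"
  by (simp add: gradient_def matrix_def matrix_vector_mult_def axis_def left_diff_distrib
        sum_subtractf if_distrib[of "\<lambda>x. x * _"] cong: if_cong)

text \<open>This is the Dirichlet energy of \<open>u\<close>, from which invertibility of the
  interior Laplacian is derived.\<close>

lemma laplacian_quadratic_form:
  "u \<bullet> (laplacian N s *v u) = (\<Sum>k\<in>UNIV. s $ k * (u $ src N k - u $ tgt N k)\<^sup>2)"
proof -
  have "u \<bullet> (laplacian N s *v u) = (gradient N *v u) \<bullet> (diag_matrix s *v (gradient N *v u))"
    unfolding laplacian_def matrix_vector_mul_assoc[symmetric] transpose_matrix_vector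
    by (metis dot_lmul_matrix inner_commute)
  also have "\<dots> = (\<Sum>k\<in>UNIV. s $ k * (u $ src N k - u $ tgt N k)\<^sup>2)"
  proof -
    have "(diag_matrix s *v w) $ k = s $ k * w $ k" for w k
      by (simp add: diag_matrix_def matrix_vector_mult_def if_distrib[of "\<lambda>x. x * _"] cong: if_cong)
    then show ?thesis
      by (simp add: inner_vec_def gradient_mult_nth power2_eq_square mult_ac)
  qed
  finally show ?thesis .
qed

section \<open>Splitting of the Laplacian and the Green function of the network\<close>

context layered_network
begin

abbreviation "J \<equiv> restriction (int_node N)"
abbreviation "R \<equiv> restriction (bd_node N)"
abbreviation "L \<equiv> laplacian N (conductivity N)"
abbreviation "Lp \<equiv> laplacian N (sigma_plus N)"
abbreviation "Lm \<equiv> laplacian N (sigma_minus N)"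
abbreviation "A \<equiv> J ** L ** transpose J"
abbreviation "P \<equiv> set_projection (- B_set N)"
abbreviation "X \<equiv> set_projection (B_set N \<union> Omega_plus N)"

lemma int_node_simps: "inj (int_node N)" "range (int_node N) = - B_set N"
  using int_node by (auto simp: bij_betw_def)

lemma bd_node_simps: "inj (bd_node N)" "range (bd_node N) = bd_Omega N"
  using bd_node by (auto simp: bij_betw_def)

lemma laplacian_split: "Lp + Lm = L"
proof -
  have "sigma_plus N + sigma_minus N = conductivity N"
    using partition_of_unity
    by (simp add: sigma_plus_def sigma_minus_def flip: distrib_right)
  then show ?thesis
    by (metis laplacian_add)
qed

lemma p_plus_minus: "p_plus N $ k + p_minus N $ k = 1"
  using partition_of_unity by (metis vector_add_component one_index)

text \<open>Every edge at a node of \<open>Omega_minus N\<close> has \<open>p_minus\<close> equal to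
  1, so the partition of unity leaves it no plus conductivity.\<close>

lemma Lp_row_eq_0: "i \<in> Omega_minus N \<Longrightarrow> Lp $ i $ j = 0"
proof (rule laplacian_row_eq_0)
  fix k assume "i \<in> Omega_minus N" "i \<in> {src N k, tgt N k}"
  then have "p_minus N $ k = 1"
    by (intro p_minus_edges) (auto simp: edges_minus_def)
  then show "sigma_plus N $ k = 0"
    using p_plus_minus[of k] by (simp add: sigma_plus_def)
qed

lemma Lm_row_eq_0: "i \<in> B_set N \<union> Omega_plus N \<Longrightarrow> Lm $ i $ j = 0"
proof (rule laplacian_row_eq_0)
  fix k assume "i \<in> B_set N \<union> Omega_plus N" "i \<in> {src N k, tgt N k}"
  then have "p_plus N $ k = 1"
    by (intro p_plus_edges) (auto simp: edges_plus_def)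
  then show "sigma_minus N $ k = 0"
    using p_plus_minus[of k] by (simp add: sigma_minus_def)
qed

lemma X_Lm_eq_0: "X ** Lm = 0"
  using Lm_row_eq_0 by (auto simp: vec_eq_iff set_projection_mult_nth indicator_def)

lemma Lp_eq_bd_plus_X: "transpose R ** R ** Lp + X ** Lp = Lp"
proof -
  have "indicator (bd_Omega N) i * Lp $ i $ j + indicator (B_set N \<union> Omega_plus N) i * Lp $ i $ j
      = Lp $ i $ j" for i j
  proof (cases "i \<in> Omega_minus N")
    case True
    then show ?thesis by (simp add: Lp_row_eq_0)
  next
    case False
    then have "i \<in> bd_Omega N \<longleftrightarrow> i \<notin> B_set N \<union> Omega_plus N"
      using cover disjoint_sets by blast
    then show ?thesis by (auto simp: indicator_def)
  qed
  then show ?thesis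
    by (simp add: transpose_mult_restriction bd_node_simps vec_eq_iff set_projection_mult_nth)
qed

lemma constant_if_edges_constant:
  assumes "\<And>k. u (src N k) = u (tgt N k)"
  shows "u a = u b"
  using connected_graph[of a b]
proof (induction rule: rtrancl_induct)
  case (step y z)
  from step.hyps(2) obtain k where "{src N k, tgt N k} = {y, z}"
    by (auto simp: adjacency_def)
  with assms[of k] have "u y = u z"
    by (auto simp: doubleton_eq_iff)
  with step.IH show ?case by simp
qed simp

text \<open>A kernel vector, extended by zero to \<open>B\<close>, has zero Dirichlet energy. By
  connectedness it is constant, and it vanishes at some node of the nonempty set
  \<open>B\<close>.\<close>

lemma invertible_interior_laplacian: "invertible A"
proof -
  have "x = 0" if x: "A *v x = 0" for x
  proof -
    define u where "u = transpose J *v x"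
    have "u \<bullet> (L *v u) = x \<bullet> (A *v x)"
      unfolding u_def matrix_vector_mul_assoc[symmetric] transpose_matrix_vector
      by (metis dot_lmul_matrix)
    with x have "(\<Sum>k\<in>UNIV. conductivity N $ k * (u $ src N k - u $ tgt N k)\<^sup>2) = 0"
      by (simp add: laplacian_quadratic_form)
    then have "conductivity N $ k * (u $ src N k - u $ tgt N k)\<^sup>2 = 0" for k
      by (subst (asm) sum_nonneg_eq_0_iff) (auto intro!: mult_nonneg_nonneg less_imp_le[OF conductivity_pos])
    then have "u $ src N k = u $ tgt N k" for k
      using conductivity_pos[of k] by (metis less_irrefl mult_eq_0_iff right_minus_eq zero_eq_power2)
    then have const: "u $ a = u $ b" for a b
      by (rule constant_if_edges_constant)
    obtain b where b: "b \<in> B_set N"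
      using nonempty by blast
    then have "int_node N i \<noteq> b" for i
      using int_node_simps(2) by auto
    then have "u $ b = 0"
      by (simp add: u_def matrix_vector_mult_def transpose_def restriction_nth
          del: transpose_matrix_vector)
    with const have "u = 0"
      by (metis vec_eq_iff zero_index)
    moreover have "J *v u = x"
      by (simp add: u_def matrix_vector_mul_assoc restriction_mult_transpose int_node_simps
          del: transpose_matrix_vector)
    ultimately show "x = 0" by simp
  qed
  then show ?thesis
    by (simp add: invertible_left_inverse matrix_left_invertible_ker)
qed

lemma green_eq: "green N = transpose J ** matrix_inv A ** J"
  by (simp add: green_def submatrix_eq)

lemma P_eq: "transpose J ** J = P"
  by (simp add: transpose_mult_restriction int_node_simps)

lemma green_P: "green N ** P = green N"
proof -
  have "green N ** P = transpose J ** matrix_inv A ** (J ** transpose J) ** J"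
    by (simp add: green_eq matrix_mul_assoc flip: P_eq)
  then show ?thesis
    by (simp add: restriction_mult_transpose int_node_simps green_eq)
qed

lemma P_laplacian_green: "P ** L ** green N = P"
proof -
  have "P ** L ** green N = transpose J ** (A ** matrix_inv A) ** J"
    by (simp add: green_eq matrix_mul_assoc flip: P_eq)
  then show ?thesis
    by (simp add: matrix_inv_inverse(1)[OF invertible_interior_laplacian] P_eq)
qed

lemma green_sym: "transpose (green N) = green N"
proof -
  have symA: "transpose A = A"
    by (simp add: matrix_transpose_mul laplacian_sym matrix_mul_assoc)
  have inv: "A ** matrix_inv A = mat 1" "matrix_inv A ** A = mat 1"
    by (simp_all only: matrix_inv_inverse[OF invertible_interior_laplacian])
  \<comment> \<open>Inserting the identity as \<open>transpose A ** matrix_inv A\<close> lets the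
    transposed inverse cancel against \<open>transpose A\<close>.\<close>
  have "transpose (matrix_inv A) = transpose (matrix_inv A) ** (transpose A ** matrix_inv A)"
    by (simp only: symA inv matrix_mul_rid)
  also have "\<dots> = transpose (A ** matrix_inv A) ** matrix_inv A"
    by (simp only: matrix_transpose_mul[of A] matrix_mul_assoc)
  also have "\<dots> = matrix_inv A"
    by (simp only: inv transpose_mat matrix_mul_lid)
  finally have "transpose (matrix_inv A) = matrix_inv A" .
  then show ?thesis
    unfolding green_eq
    by (simp only: matrix_transpose_mul[of _ J] matrix_transpose_mul[of _ "matrix_inv A"]
        transpose_transpose matrix_mul_assoc)
qed

lemma R_P: "R ** P = R"
proof -
  have "bd_node N i \<notin> B_set N" for i
    using bd_node_simps(2) disjoint_sets by blast
  then show ?thesis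
    by (auto simp: vec_eq_iff mult_set_projection_nth restriction_nth)
qed

lemma P_X: "P ** X = X ** P"
  by (simp add: vec_eq_iff set_projection_mult_nth)
    (simp add: set_projection_def diag_matrix_def)

lemma calderon_data: "calderon_data R (green N) X Lp Lm"
proof
  show "R ** transpose R = mat 1"
    by (simp add: restriction_mult_transpose bd_node_simps)
  show "R ** X = 0"
    using disjoint_sets by (intro restriction_mult_set_projection) (auto simp: bd_node_simps)
  show "R ** (Lp + Lm) ** green N = R"
    by (metis laplacian_split R_P P_laplacian_green matrix_mul_assoc)
  show "green N ** X ** (Lp + Lm) ** green N = green N ** X"
  proof -
    \<comment> \<open>The projection \<open>P\<close> is drawn out of the Green function and
      commuted past \<open>X\<close>, so that it stands next to \<open>L\<close>, where
      \<open>P_laplacian_green\<close> applies.\<close>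
    have "green N ** X ** L ** green N = green N ** (P ** X) ** L ** green N"
      by (simp add: matrix_mul_assoc green_P)
    also have "\<dots> = green N ** X ** (P ** L ** green N)"
      by (simp only: P_X matrix_mul_assoc)
    also have "\<dots> = green N ** (P ** X)"
      by (simp only: P_laplacian_green P_X matrix_mul_assoc)
    also have "\<dots> = green N ** X"
      by (simp add: matrix_mul_assoc green_P)
    finally show ?thesis
      by (simp only: laplacian_split)
  qed
qed (simp_all add: green_sym transpose_set_projection laplacian_sym X_Lm_eq_0 Lp_eq_bd_plus_X)

end

section \<open>The four identities for the boundary layer operators\<close>

theorem corollary3p1:
  fixes N :: "('v::finite, 'e::finite, 'o::finite, 'd::finite) network"
  assumes "layered_network N"
  shows "S_op N ** H_op N = - (D_op N ** D_op N) + (1/4) *\<^sub>R mat 1 \<and>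
         H_op N ** S_op N = - (D'_op N ** D'_op N) + (1/4) *\<^sub>R mat 1 \<and>
         S_op N ** D'_op N = D_op N ** S_op N \<and>
         D'_op N ** H_op N = H_op N ** D_op N"
proof -
  interpret layered_network N by fact
  interpret calderon_data R "green N" X Lp Lm by (rule calderon_data)
  have S: "S_op N = S"
    by (simp add: S_op_def gamma0_def single_layer_potential_def matrix_mul_assoc)
  have H: "H_op N = H"
    by (simp add: H_op_def gamma1_plus_def gamma1_minus_def double_layer_potential_minus_def
        matrix_transpose_mul laplacian_sym matrix_minus_left matrix_mul_assoc)
  have "D_op N = (1/2) *\<^sub>R (Km - K)"
    by (simp add: D_op_def gamma0_def gamma1_plus_def gamma1_minus_def
        double_layer_potential_plus_def double_layer_potential_minus_def matrix_transpose_mul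
        laplacian_sym transpose_uminus matrix_minus_right matrix_diff_ldistrib matrix_mul_assoc)
  \<comment> \<open>The jump relation rewrites the mean of the two traces through either one alone;
    both forms serve below.\<close>
  then have D: "D_op N = (1/2) *\<^sub>R mat 1 - K" "D_op N = Km - (1/2) *\<^sub>R mat 1"
    unfolding jump[symmetric] by (simp_all add: vec_eq_iff field_simps)
  have "D'_op N = (1/2) *\<^sub>R (Km' - K')"
    by (simp add: D'_op_def gamma1_plus_def gamma1_minus_def single_layer_potential_def gamma0_def
        matrix_minus_left matrix_diff_rdistrib matrix_mul_assoc)
  then have D': "D'_op N = (1/2) *\<^sub>R mat 1 - K'" "D'_op N = Km' - (1/2) *\<^sub>R mat 1"
    unfolding jump'[symmetric] by (simp_all add: vec_eq_iff field_simps)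
  have half: "((1/2) *\<^sub>R mat 1) ** M = (1/2) *\<^sub>R M" "M ** ((1/2) *\<^sub>R mat 1) = (1/2) *\<^sub>R M"
    for M :: "real ^ 'd ^ 'd"
    by (simp_all add: matrix_scalar_ac flip: scalar_matrix_assoc)
  have square: "M ** M = (1/4) *\<^sub>R mat 1 - U ** V"
    if "M = (1/2) *\<^sub>R mat 1 - U" "M = V - (1/2) *\<^sub>R mat 1" for M U V :: "real ^ 'd ^ 'd"
  proof -
    \<comment> \<open>The product \<open>U ** V\<close> is now a difference of squares, I/2 - M
      times I/2 + M.\<close>
    have "U = (1/2) *\<^sub>R mat 1 - M" "V = M + (1/2) *\<^sub>R mat 1"
      by (simp add: that(1), simp add: that(2))
    then show ?thesis
      by (simp add: matrix_diff_rdistrib matrix_add_ldistrib half)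
        (simp add: vec_eq_iff field_simps)
  qed
  \<comment> \<open>\<open>H_S\<close> yields the factors in the order opposite to
    \<open>square\<close>; they commute because their sum is the identity.\<close>
  have "Km' ** K' = K' ** Km'"
  proof -
    have "Km' = mat 1 - K'"
      using jump' by (simp add: algebra_simps)
    then show ?thesis
      by (simp only: matrix_diff_ldistrib matrix_diff_rdistrib matrix_mul_lid matrix_mul_rid)
  qed
  then have "H ** S = - (D'_op N ** D'_op N) + (1/4) *\<^sub>R mat 1"
    using square[OF D'] by (simp add: H_S)
  moreover have "S ** H = - (D_op N ** D_op N) + (1/4) *\<^sub>R mat 1"
    using square[OF D] by (simp add: S_H)
  moreover have "S ** D'_op N = D_op N ** S"
    unfolding D(1) D'(1) matrix_diff_ldistrib matrix_diff_rdistrib half S_K' ..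
  \<comment> \<open>\<open>K'_H\<close> links \<open>K'\<close> to \<open>Km\<close>, so the first
    form of \<open>D'_op N\<close> is paired with the second form of \<open>D_op N\<close>.\<close>
  moreover have "D'_op N ** H = H ** D_op N"
  proof -
    have "K' ** H = H - H ** Km"
      using K'_H by (simp add: algebra_simps)
    then have "D'_op N ** H = (1/2) *\<^sub>R H - (H - H ** Km)"
      unfolding D'(1) matrix_diff_rdistrib half by simp
    also have "\<dots> = H ** Km - (1/2) *\<^sub>R H"
      by (simp add: vec_eq_iff)
    finally show ?thesis
      unfolding D(2) matrix_diff_ldistrib half .
  qed
  ultimately show ?thesis
    by (simp only: S H)
qed

end
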